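(* Let $n,m\ge1$ and $d=nm(m+1)/2$. There exists a set $X\subset\mathbb{T}^d$ such that every stratum of $X$ is a finite union of hyperplanes and such that the following holds for every sequence $Q^{(1)},\dots,Q^{(n)}\in\mathbb{T}_\pm^{m\times m}$ of symmetric tropical matrices: if the vector with entries $|Q^{(k)}_{ij}|$ ($k\in[n]$, $1\le i\le j\le m$) does not belong to $X$, then (i) for every $k\in[n]$ and every pair $i\neq j$ in $[m]$ such that $Q^{(k)}_{ii},Q^{(k)}_{jj}\in\mathbb{T}_+$, we have $Q^{(k)}_{ii}+Q^{(k)}_{jj}\neq2|Q^{(k)}_{ij}|$; and (ii) for every $\Sigma\subset\{(i,j)\in[m]^2:i<j\}$ and every $\Diamond\in\{\le,\ge\}^{\Sigma^\complement}$, every stratum of $\mathcal{S}_{\Sigma,\Diamond}(Q^{(1)},\dots,Q^{(n)})$ is regular.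
   Context: $[k]=\{1,\dots,k\}$. $\mathbb{T}=\mathbb{R}\cup\{-\infty\}$ with its usual order and addition ($-\infty$ absorbing). $\mathbb{T}_\pm$ is the set of signed tropical numbers: pairs $(1,a)$ (written $a$; the set of these is $\mathbb{T}_+$), pairs $(-1,a)$ (written $\ominus a$; the set of these is $\mathbb{T}_-$), with $a\in\mathbb{R}$, and $-\infty$ (sign $0$). Modulus: $|a|=|\ominus a|=a$ and $|-\infty|=-\infty$. For symmetric $Q^{(1)},\dots,Q^{(n)}\in\mathbb{T}_\pm^{m\times m}$, $i,j\in[m]$ and $x\in\mathbb{T}^n$, put $Q^+_{ij}(x)=\max\{|Q^{(k)}_{ij}|+x_k : k\in[n],\,Q^{(k)}_{ij}\in\mathbb{T}_+\}$ and $Q^-_{ij}(x)=\max\{|Q^{(k)}_{ij}|+x_k : k\in[n],\,Q^{(k)}_{ij}\in\mathbb{T}_-\}$, with $\max\emptyset=-\infty$. For $\Sigma\subset\{(i,j)\in[m]^2:i<j\}$, $\Sigma^\complement=\{(i,j)\in[m]^2:i<j,(i,j)\notin\Sigma\}$. For $\Diamond\in\{\le,\ge\}^{\Sigma^\complement}$, $\mathcal{S}_{\Sigma,\Diamond}(Q^{(1)},\dots,Q^{(n)})$ is the set of $x\in\mathbb{T}^n$ such that: for all $i\in[m]$, $Q^+_{ii}(x)\ge Q^-_{ii}(x)$; for all $(i,j)\in\Sigma$, $Q^+_{ii}(x)+Q^+_{jj}(x)\ge 2\max(Q^+_{ij}(x),Q^-_{ij}(x))$; for all $(i,j)\in\Sigma^\complement$,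 $Q^+_{ij}(x)\mathrel{\Diamond_{(i,j)}}Q^-_{ij}(x)$. The support of $x\in\mathbb{T}^p$ is $\{k: x_k\ne-\infty\}$. For nonempty $K\subset[p]$, the stratum of $S\subset\mathbb{T}^p$ associated with $K$ is the set of $(x_k)_{k\in K}\in\mathbb{R}^K$ for $x\in S$ with support exactly $K$. A set $S\subset\mathbb{R}^p$ is regular if it is closed and $S=\mathrm{cl}(\mathrm{int}(S))$ (Euclidean topology). A hyperplane of $\mathbb{R}^K$ is an affine subspace of codimension one; a finite union of hyperplanes may be empty. *)

theory Defs
  imports "HOL-Analysis.Analysis"
begin

text \<open>
  The index sets \<open>[n]\<close> and \<open>[m]\<close> are represented by finite types \<open>'n\<close> and \<open>'m\<close>, the latter linearly
  ordered.  The tropical semifield \<open>\<real> \<union> {-\<infinity>}\<close> is the set of extended reals other than \<open>\<infinity>\<close>.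
\<close>

definition tropical_space :: "(ereal ^ 'p) set"
  where "tropical_space = {x. \<forall>k. x $ k \<noteq> \<infinity>}"

datatype signed_tropical = TPos real | TNeg real | TZero

definition tropical_pos :: "signed_tropical set"
  where "tropical_pos = range TPos"

definition tropical_neg :: "signed_tropical set"
  where "tropical_neg = range TNeg"

fun modulus :: "signed_tropical \<Rightarrow> ereal" where
  "modulus (TPos a) = ereal a"
| "modulus (TNeg a) = ereal a"
| "modulus TZero = -\<infinity>"

text \<open>
  The suprema below range over finite sets, so they are maxima, and the supremum of the empty set
  in \<^typ>\<open>ereal\<close> is \<open>-\<infinity>\<close>.
\<close>

definition Qplus :: "('n::finite \<Rightarrow> signed_tropical ^ 'm ^ 'm) \<Rightarrow> 'm \<Rightarrow> 'm \<Rightarrow> ereal ^ 'n \<Rightarrow> ereal"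
  where "Qplus Q i j x = (SUP k \<in> {k. Q k $ i $ j \<in> tropical_pos}. modulus (Q k $ i $ j) + x $ k)"

definition Qminus :: "('n::finite \<Rightarrow> signed_tropical ^ 'm ^ 'm) \<Rightarrow> 'm \<Rightarrow> 'm \<Rightarrow> ereal ^ 'n \<Rightarrow> ereal"
  where "Qminus Q i j x = (SUP k \<in> {k. Q k $ i $ j \<in> tropical_neg}. modulus (Q k $ i $ j) + x $ k)"

definition strict_pairs :: "('m::linorder \<times> 'm) set"
  where "strict_pairs = {(i, j). i < j}"

text \<open>
  The sign pattern \<open>D\<close> assigns to each pair in the complement of \<open>\<Sigma>\<close> one of the two relations
  \<open>\<le>\<close> and \<open>\<ge>\<close>; its values elsewhere are irrelevant.
\<close>

definition tropical_S ::
  "('m \<times> 'm) set \<Rightarrow> ('m \<times> 'm \<Rightarrow> ereal \<Rightarrow> ereal \<Rightarrow> bool) \<Rightarrow>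
   ('n::finite \<Rightarrow> signed_tropical ^ ('m::{finite,linorder}) ^ ('m::{finite,linorder})) \<Rightarrow> (ereal ^ 'n) set"
  where "tropical_S \<Sigma> D Q = {x \<in> tropical_space.
    (\<forall>i. Qplus Q i i x \<ge> Qminus Q i i x) \<and>
    (\<forall>(i, j) \<in> \<Sigma>. Qplus Q i i x + Qplus Q j j x \<ge> 2 * max (Qplus Q i j x) (Qminus Q i j x)) \<and>
    (\<forall>(i, j) \<in> strict_pairs - \<Sigma>. D (i, j) (Qplus Q i j x) (Qminus Q i j x))}"

definition support :: "ereal ^ 'p \<Rightarrow> 'p set"
  where "support x = {k. x $ k \<noteq> -\<infinity>}"

text \<open>
  For a set \<open>K\<close> of indices, \<open>\<real>\<^sup>K\<close> is represented by the coordinate subspace of the vectors that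
  vanish outside \<open>K\<close>.  Since \<open>real_of_ereal (-\<infinity>) = 0\<close>, the map in \<open>stratum\<close> sends a point with
  support \<open>K\<close> to the representative of its family of finite coordinates.
\<close>

definition coord_space :: "'p::finite set \<Rightarrow> (real ^ 'p) set"
  where "coord_space K = {y. \<forall>k. k \<notin> K \<longrightarrow> y $ k = 0}"

definition stratum :: "'p::finite set \<Rightarrow> (ereal ^ 'p) set \<Rightarrow> (real ^ 'p) set"
  where "stratum K S = (\<lambda>x. \<chi> k. real_of_ereal (x $ k)) ` {x \<in> S. support x = K}"

definition regular_in :: "'p::finite set \<Rightarrow> (real ^ 'p) set \<Rightarrow> bool"
  where "regular_in K S \<longleftrightarrow>
    closedin (top_of_set (coord_space K)) S \<and>
    S = top_of_set (coord_space K) closure_of (top_of_set (coord_space K) interior_of S)"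

definition hyperplane_in :: "'p::finite set \<Rightarrow> (real ^ 'p) set \<Rightarrow> bool"
  where "hyperplane_in K H \<longleftrightarrow>
    H \<subseteq> coord_space K \<and> affine H \<and> aff_dim H + 1 = aff_dim (coord_space K)"

definition finite_union_of_hyperplanes_in :: "'p::finite set \<Rightarrow> (real ^ 'p) set \<Rightarrow> bool"
  where "finite_union_of_hyperplanes_in K S \<longleftrightarrow>
    (\<exists>\<H>. finite \<H> \<and> (\<forall>H\<in>\<H>. hyperplane_in K H) \<and> S = \<Union>\<H>)"

text \<open>
  Pairs \<open>(i, j)\<close> with \<open>i \<le> j\<close> index the entries of a symmetric matrix; \<open>'n \<times> 'm upper_pair\<close> is the
  index type of the tropical space of dimension \<open>d\<close>, and \<open>card_entry_index\<close> confirms its size.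
\<close>

typedef (overloaded) 'm upper_pair = "{(i, j). i \<le> (j::'m::linorder)}"
  by auto

lemma range_Rep_upper_pair: "range Rep_upper_pair = {(i, j). i \<le> (j::'m::linorder)}"
  using type_definition.Rep_range[OF type_definition_upper_pair] .

instance upper_pair :: ("{finite,linorder}") finite
proof
  show "finite (UNIV :: 'a upper_pair set)"
    by (rule finite_imageD[of Rep_upper_pair]) (auto simp: inj_on_def Rep_upper_pair_inject)
qed

lemma card_upper_pair:
  "2 * CARD('m::{finite,linorder} upper_pair) = CARD('m) * (CARD('m) + 1)"
proof -
  let ?U = "{(i, j). i \<le> (j::'m)}" and ?L = "{(i, j). j \<le> (i::'m)}"
  have U: "CARD('m upper_pair) = card ?U"
    using type_definition.card[OF type_definition_upper_pair] .
  have "?L = prod.swap ` ?U" by force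
  then have L: "card ?L = card ?U"
    by (simp add: card_image inj_on_def)
  have "?U \<union> ?L = UNIV" "?U \<inter> ?L = range (\<lambda>i. (i, i))" by auto
  moreover have "card (range (\<lambda>i::'m. (i, i))) = CARD('m)"
    by (simp add: card_image inj_on_def)
  ultimately have "card ?U + card ?L = CARD('m \<times> 'm) + CARD('m)"
    using card_Un_Int[of ?U ?L] by simp
  then show ?thesis using U L by (simp add: algebra_simps)
qed

lemma card_entry_index:
  "CARD('n::finite \<times> 'm::{finite,linorder} upper_pair) = CARD('n) * CARD('m) * (CARD('m) + 1) div 2"
proof -
  have "CARD('n) * CARD('m) * (CARD('m) + 1) = CARD('n) * CARD('m upper_pair) * 2"
    using arg_cong[OF card_upper_pair[where 'm = 'm], of "\<lambda>c. CARD('n) * c"]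
    by (simp only: mult_ac)
  then show ?thesis by (simp add: card_prod)
qed

definition moduli_vector ::
  "('n::finite \<Rightarrow> signed_tropical ^ ('m::{finite,linorder}) ^ ('m::{finite,linorder})) \<Rightarrow>
   ereal ^ ('n \<times> 'm upper_pair)"
  where "moduli_vector Q =
    (\<chi> e. case e of (k, p) \<Rightarrow> (case Rep_upper_pair p of (i, j) \<Rightarrow> modulus (Q k $ i $ j)))"

end

theory Submission imports Defs begin

text \<open>
  Fix the support \<open>K\<close> of the point.  An entry \<open>e\<close> of the matrix number \<open>k\<close>, with modulus \<open>r\<^sub>e\<close>,
  has at the point \<open>y\<close> the value \<open>r\<^sub>e + y\<^sub>k\<close>.  After the maxima are spelled out, every defining
  condition of the stratum has the form: for each entry \<open>h\<close> of a set \<open>N\<close> there are entries \<open>e \<in> P\<close>,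
  \<open>e' \<in> P'\<close> whose values add up to at least twice the value of \<open>h\<close>.  (A comparison of two maxima is
  the case \<open>P = P'\<close>.)  So the stratum is a finite combination of unions and intersections of
  half-spaces, and it is closed.  It is regular as soon as from each of its points some direction \<open>v\<close>
  leads at once into the set where all conditions are strict, and for this it suffices that \<open>v\<close>
  strictly increases the slack of each tight triple \<open>(e, e', h)\<close>, one whose slack is zero.

  Such a \<open>v\<close> is a solution of a finite homogeneous system of strict linear inequalities.  By Gordan's
  alternative, if there is none, then some convex combination of the gradients of the slacks is zero.
  In the same combination of the equations saying that the triples are tight, the unknowns \<open>y\<close>
  cancel, and a linear equation \<open>u \<bullet> r = 0\<close> between the moduli is left.  It is not trivial: the
  heads \<open>h\<close> are never among the tails \<open>e\<close>, \<open>e'\<close> of any triple, because an entry of the diagonal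
  is a head or a tail according to its sign, an entry with index in \<open>\<Sigma>\<close> is always a head, and any
  other entry is a head or a tail according to its sign and to the side on which \<open>\<Diamond>\<close> puts it.
  Hence the coefficients of the heads in \<open>u\<close> have a negative sum.

  Whether the gradients of a set of triples satisfy such a relation does not depend on \<open>r\<close> or \<open>y\<close>.
  There are finitely many sets of triples, so one relation for each of them gives a finite list of
  hyperplanes in each stratum, and \<open>exceptional_set\<close> is their union.  The first claim of the theorem is the same
  alternative for the single triple \<open>(Q\<^sub>i\<^sub>i, Q\<^sub>j\<^sub>j, Q\<^sub>i\<^sub>j)\<close> of entries of one matrix: its gradient is
  zero, so no direction can increase its slack.
\<close>

section \<open>Relations between the entries of tight triples\<close>

text \<open>
  The coefficients of the slack of the triple \<open>(e, e', h)\<close>: tails \<open>e\<close>, \<open>e'\<close> count positively, the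
  head \<open>h\<close> counts twice negatively.  The tails may coincide.
\<close>

definition exchange :: "'e::finite \<times> 'e \<times> 'e \<Rightarrow> real ^ 'e"
  where "exchange = (\<lambda>(e, e', h). axis e 1 + axis e' 1 - 2 *\<^sub>R axis h 1)"

lemma inner_exchange: "exchange (e, e', h) \<bullet> z = z $ e + z $ e' - 2 * z $ h"
  by (simp add: exchange_def inner_add_left inner_diff_left inner_axis')

text \<open>
  An index in \<open>'n \<times> 'p\<close> is an entry \<open>p\<close> of matrix \<open>k\<close>.  The variable \<open>y\<^sub>k\<close> is added to all entries of
  matrix \<open>k\<close>, so as a function of \<open>y\<close> the slack of \<open>g\<close> is \<open>exchange g \<bullet> (r + fibre_lift y)\<close>, and its
  gradient is \<open>fibre_sum (exchange g)\<close> since the two maps below are adjoint.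
\<close>

definition fibre_lift :: "real ^ 'n \<Rightarrow> real ^ ('n::finite \<times> 'p::finite)"
  where "fibre_lift y = (\<chi> e. y $ fst e)"

definition fibre_sum :: "real ^ ('n::finite \<times> 'p::finite) \<Rightarrow> real ^ 'n"
  where "fibre_sum u = (\<chi> k. \<Sum>p\<in>UNIV. u $ (k, p))"

lemma fibre_lift_nth [simp]: "fibre_lift y $ e = y $ fst e"
  by (simp add: fibre_lift_def)

lemma inner_fibre_sum: "fibre_sum u \<bullet> y = u \<bullet> fibre_lift y"
  by (simp add: inner_vec_def fibre_sum_def sum_distrib_right sum.cartesian_product
      flip: UNIV_Times_UNIV) (simp add: case_prod_beta)

lemma linear_fibre_sum: "linear fibre_sum"
  by (rule linearI) (simp_all add: fibre_sum_def vec_eq_iff sum.distrib sum_distrib_left)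

text \<open>
  Gordan's alternative for the gradients \<open>fibre_sum (exchange g)\<close>: their convex hull is compact, so it
  either contains zero or is strictly separated from it by some \<open>v\<close>.  In the first case the convex
  combination is kept upstairs, as a vector \<open>u\<close> of coefficients on entries.
\<close>

lemma exchange_alternative:
  fixes G :: "(('n::finite \<times> 'p::finite) \<times> ('n \<times> 'p) \<times> ('n \<times> 'p)) set"
  obtains v where "\<And>g. g \<in> G \<Longrightarrow> 0 < exchange g \<bullet> fibre_lift v"
  | u where "u \<in> convex hull (exchange ` G)" "fibre_sum u = 0"
proof (cases "0 \<in> fibre_sum ` (convex hull (exchange ` G))")
  case True
  then show ?thesis using that(2) by force
next
  case False
  define C where "C = fibre_sum ` (convex hull (exchange ` G))"
  have C: "C = convex hull (fibre_sum ` exchange ` G)"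
    by (simp add: C_def convex_hull_linear_image linear_fibre_sum)
  then have "closed C"
    by (simp add: finite_imp_compact_convex_hull compact_imp_closed)
  moreover have "convex C" "0 \<notin> C"
    using C False by (simp_all add: C_def)
  ultimately obtain v b where "0 < b" "\<forall>x\<in>C. v \<bullet> x > b"
    using separating_hyperplane_closed_0 by blast
  moreover have "fibre_sum (exchange g) \<in> C" if "g \<in> G" for g
    using that unfolding C_def by (intro imageI hull_inc)
  ultimately have "0 < fibre_sum (exchange g) \<bullet> v" if "g \<in> G" for g
    using that inner_commute[of v] by fastforce
  then show ?thesis using that(1)[of v] unfolding inner_fibre_sum by blast
qed

text \<open>
  Choosing one relation for each \<open>G\<close>, and not all, makes their number finite.  For a set \<open>G\<close> without any
  relation the value is arbitrary, which adds at most one more hyperplane to each stratum.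
\<close>

definition chosen_relation ::
  "(('n::finite \<times> 'p::finite) \<times> ('n \<times> 'p) \<times> ('n \<times> 'p)) set \<Rightarrow> real ^ ('n \<times> 'p)"
  where "chosen_relation G = (SOME u. u \<in> convex hull (exchange ` G) \<and> fibre_sum u = 0)"

section \<open>The exceptional set\<close>

definition real_part :: "ereal ^ 'e \<Rightarrow> real ^ 'e"
  where "real_part x = (\<chi> k. real_of_ereal (x $ k))"

text \<open>
  A relation is tested only on points all of whose coordinates that occur in it are finite; otherwise
  \<open>real_part\<close> would put meaningless zeros into it.
\<close>

definition exceptional_set :: "(ereal ^ ('n::finite \<times> 'p::finite)) set"
  where "exceptional_set = {x \<in> tropical_space. \<exists>u\<in>range chosen_relation.
    u \<noteq> 0 \<and> u \<in> coord_space (support x) \<and> u \<bullet> real_part x = 0}"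

lemma stratum_eq: "stratum K S = real_part ` {x \<in> S. support x = K}"
  by (simp add: stratum_def real_part_def)

lemma subspace_coord_space: "subspace (coord_space K)"
  by (auto simp: subspace_def coord_space_def)

definition from_real :: "'p set \<Rightarrow> real ^ 'p \<Rightarrow> ereal ^ 'p"
  where "from_real K y = (\<chi> k. if k \<in> K then ereal (y $ k) else -\<infinity>)"

lemma from_real:
  "from_real K y \<in> tropical_space" "support (from_real K y) = K"
  "y \<in> coord_space K \<Longrightarrow> real_part (from_real K y) = y"
  by (auto simp: from_real_def tropical_space_def support_def real_part_def coord_space_def vec_eq_iff)

lemma from_real_real_part:
  "x \<in> tropical_space \<Longrightarrow> from_real (support x) (real_part x) = x"
  by (auto simp: from_real_def tropical_space_def support_def real_part_def vec_eq_iff ereal_real)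

lemma real_part_in_coord_space: "real_part x \<in> coord_space (support x)"
  by (auto simp: real_part_def support_def coord_space_def)

lemma stratum_tropical:
  assumes "S \<subseteq> tropical_space"
  shows "stratum K S = {y \<in> coord_space K. from_real K y \<in> S}"
proof
  show "stratum K S \<subseteq> {y \<in> coord_space K. from_real K y \<in> S}"
    using assms real_part_in_coord_space by (auto simp: stratum_eq from_real_real_part subset_iff)
  show "{y \<in> coord_space K. from_real K y \<in> S} \<subseteq> stratum K S"
    by (auto simp: stratum_eq from_real intro!: image_eqI[where x = "from_real K _"])
qed

lemma hyperplane_in_orthogonal:
  assumes "u \<in> coord_space K" "u \<noteq> 0"
  shows "hyperplane_in K {y \<in> coord_space K. u \<bullet> y = 0}"
proof -
  let ?H = "{y \<in> coord_space K. u \<bullet> y = 0}"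
  have eq: "?H = {y \<in> coord_space K. \<forall>x\<in>span {u}. orthogonal x y}"
    by (auto simp: span_singleton orthogonal_def)
  have "span {u} \<subseteq> coord_space K"
    using assms subspace_coord_space by (intro span_minimal) auto
  then have "dim ?H + dim (span {u}) = dim (coord_space K)"
    unfolding eq by (intro dim_subspace_orthogonal_to_vectors subspace_span subspace_coord_space)
  moreover have "dim (span {u}) = 1"
    using assms by simp
  moreover have "subspace ?H"
    using subspace_coord_space[of K] by (auto simp: subspace_def inner_add_right)
  ultimately show ?thesis
    by (auto simp: hyperplane_in_def aff_dim_subspace subspace_coord_space subspace_imp_affine)
qed

lemma stratum_exceptional_set:
  "finite_union_of_hyperplanes_in K (stratum K exceptional_set)"
proof -
  let ?U = "{u \<in> range chosen_relation. u \<noteq> 0 \<and> u \<in> coord_space K}"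
  have "stratum K exceptional_set = (\<Union>u\<in>?U. {y \<in> coord_space K. u \<bullet> y = 0})"
    by (subst stratum_tropical) (auto simp: exceptional_set_def from_real)
  then show ?thesis
    unfolding finite_union_of_hyperplanes_in_def
    by (intro exI[of _ "(\<lambda>u. {y \<in> coord_space K. u \<bullet> y = 0}) ` ?U"])
       (auto intro: hyperplane_in_orthogonal)
qed

text \<open>
  The heart of the proof.  If there were no such direction, then the relation \<open>u\<close> chosen for \<open>G\<close> would be
  a convex combination of the vectors \<open>exchange g\<close>, and three linear properties shared by these vectors would
  pass to \<open>u\<close>: the support lies in that of \<open>x\<close>; the sum of the coordinates in the set \<open>H\<close> of heads is
  negative (it is \<open>-2\<close> for each \<open>exchange g\<close>), so \<open>u \<noteq> 0\<close>; and the product with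
  \<open>real_part x + fibre_lift y\<close> vanishes.  Since \<open>fibre_sum u = 0\<close> removes \<open>y\<close> from the last one,
  \<open>x\<close> would be exceptional.
\<close>

lemma increasing_direction:
  fixes x :: "ereal ^ ('n::finite \<times> 'p::finite)"
  assumes "x \<in> tropical_space" "x \<notin> exceptional_set"
    and supp: "\<And>e e' h. (e, e', h) \<in> G \<Longrightarrow> {e, e', h} \<subseteq> support x"
    and heads: "\<And>e e' h. (e, e', h) \<in> G \<Longrightarrow> h \<in> H \<and> e \<notin> H \<and> e' \<notin> H"
    and tight: "\<And>g. g \<in> G \<Longrightarrow> exchange g \<bullet> (real_part x + fibre_lift y) = 0"
  shows "\<exists>v. \<forall>g\<in>G. 0 < exchange g \<bullet> fibre_lift v"
proof (cases rule: exchange_alternative[of G])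
  case (1 v)
  then show ?thesis by blast
next
  case (2 u')
  define u where "u = chosen_relation G"
  have "u \<in> convex hull (exchange ` G) \<and> fibre_sum u = 0"
    unfolding u_def chosen_relation_def by (rule someI[of _ u']) (simp add: 2)
  then have hull: "u \<in> convex hull (exchange ` G)" and sum: "fibre_sum u = 0"
    by auto
  have hullI: "u \<in> C" if "convex C" "\<And>g. g \<in> G \<Longrightarrow> exchange g \<in> C" for C
    using hull hull_minimal[of "exchange ` G" C convex] that by blast
  have coord: "u \<in> coord_space (support x)"
  proof (rule hullI)
    show "exchange g \<in> coord_space (support x)" if "g \<in> G" for g
      using that supp by (cases g) (fastforce simp: coord_space_def exchange_def axis_def)
  qed (simp add: subspace_coord_space subspace_imp_convex)
  define \<chi>H :: "real ^ ('n \<times> 'p)" where "\<chi>H = (\<chi> e. if e \<in> H then 1 else 0)"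
  have "u \<in> {u. \<chi>H \<bullet> u < 0}"
  proof (rule hullI[OF convex_halfspace_lt])
    show "exchange g \<in> {u. \<chi>H \<bullet> u < 0}" if "g \<in> G" for g
    proof (cases g)
      case (fields e e' h)
      with that heads show ?thesis
        by (simp add: inner_commute[of \<chi>H] inner_exchange) (simp add: \<chi>H_def)
    qed
  qed
  then have "u \<noteq> 0" by auto
  have "u \<in> {u. (real_part x + fibre_lift y) \<bullet> u = 0}"
    by (rule hullI[OF convex_hyperplane]) (simp add: tight inner_commute)
  then have "u \<bullet> real_part x = 0"
    using inner_fibre_sum[of u y] sum by (simp add: inner_commute[of _ u] inner_add_right)
  then have "x \<in> exceptional_set"
    using coord \<open>u \<noteq> 0\<close> assms(1) by (auto simp: exceptional_set_def u_def)
  then show ?thesis using assms(2) by simp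
qed

section \<open>Regularity of sets given by dominance conditions\<close>

lemma regular_inI:
  assumes "closedin (top_of_set (coord_space K)) S" "openin (top_of_set (coord_space K)) U"
    and "U \<subseteq> S" "S \<subseteq> closure U"
  shows "regular_in K S"
proof -
  let ?V = "top_of_set (coord_space K)"
  have "S \<subseteq> coord_space K" using closedin_subset[OF assms(1)] by simp
  moreover have "?V closure_of U = coord_space K \<inter> closure U"
    using assms(3) calculation by (simp add: closure_of_subtopology Int_absorb1)
  ultimately have "S \<subseteq> ?V closure_of U" using assms(4) by auto
  also have "\<dots> \<subseteq> ?V closure_of (?V interior_of S)"
    using assms by (intro closure_of_mono interior_of_maximal)
  finally have "S \<subseteq> ?V closure_of (?V interior_of S)" .
  moreover have "?V closure_of (?V interior_of S) \<subseteq> S"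
    using assms(1) by (intro closure_of_minimal interior_of_subset)
  ultimately show ?thesis using assms(1) by (auto simp: regular_in_def)
qed

text \<open>
  A condition \<open>(P, P', N)\<close> says that twice the largest value on \<open>N\<close> is at most the sum of the largest
  values on \<open>P\<close> and on \<open>P'\<close>.  Written with quantifiers, it needs no convention for empty maxima.
\<close>

definition dominance_set :: "'n set \<Rightarrow> real ^ ('n \<times> 'p::finite)
    \<Rightarrow> (('n \<times> 'p) set \<times> ('n \<times> 'p) set \<times> ('n \<times> 'p) set) set \<Rightarrow> (real ^ ('n::finite)) set"
  where "dominance_set K r \<C> = {y \<in> coord_space K. \<forall>(P, P', N)\<in>\<C>. \<forall>h\<in>N. \<exists>e\<in>P. \<exists>e'\<in>P'.
    0 \<le> exchange (e, e', h) \<bullet> (r + fibre_lift y)}"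

text \<open>
  Let \<open>G\<close> be the set of all triples of the conditions that are tight at \<open>y\<close>.  A direction that increases the
  slacks of \<open>G\<close> makes every condition strict for small times: the witness \<open>(e, e', h)\<close> of a condition
  at \<open>y\<close> has positive slack, which persists by continuity, or slack zero, and then it belongs to \<open>G\<close>.
\<close>

lemma regular_dominance_set:
  fixes x :: "ereal ^ ('n::finite \<times> 'p::finite)"
  assumes x: "x \<in> tropical_space" "x \<notin> exceptional_set"
    and dom: "\<And>P P' N. (P, P', N) \<in> \<C> \<Longrightarrow> P \<union> P' \<union> N \<subseteq> support x \<inter> fst -` K"
    and heads: "\<And>P P' N. (P, P', N) \<in> \<C> \<Longrightarrow> N \<subseteq> H \<and> P \<inter> H = {} \<and> P' \<inter> H = {}"
  shows "regular_in K (dominance_set K (real_part x) \<C>)"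
proof -
  define r where "r = real_part x"
  define slack where "slack g y = exchange g \<bullet> (r + fibre_lift y)" for g and y :: "real ^ 'n"
  define S where "S = dominance_set K r \<C>"
  define U where "U = {y \<in> coord_space K. \<forall>(P, P', N)\<in>\<C>. \<forall>h\<in>N. \<exists>e\<in>P. \<exists>e'\<in>P'.
    0 < slack (e, e', h) y}"
  have S: "S = {y \<in> coord_space K. \<forall>(P, P', N)\<in>\<C>. \<forall>h\<in>N. \<exists>e\<in>P. \<exists>e'\<in>P'.
    0 \<le> slack (e, e', h) y}"
    by (simp add: S_def dominance_set_def slack_def)
  have slack: "slack g y = exchange g \<bullet> r + fibre_sum (exchange g) \<bullet> y" for g y
    by (simp add: slack_def inner_add_right inner_fibre_sum)
  have cont: "continuous_on UNIV (slack g)" for g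
    unfolding slack by (intro continuous_intros)
  have "S = coord_space K \<inter>
      (\<Inter>(P, P', N)\<in>\<C>. \<Inter>h\<in>N. \<Union>e\<in>P. \<Union>e'\<in>P'. {y. 0 \<le> slack (e, e', h) y})"
    unfolding S by (auto; blast)
  moreover have "closed (\<Inter>(P, P', N)\<in>\<C>. \<Inter>h\<in>N. \<Union>e\<in>P. \<Union>e'\<in>P'. {y. 0 \<le> slack (e, e', h) y})"
    by (auto intro!: closed_INT closed_UN closed_Collect_le continuous_on_const cont)
  ultimately have closed: "closedin (top_of_set (coord_space K)) S"
    by (simp add: closedin_closed_Int)
  have "U = coord_space K \<inter>
      (\<Inter>(P, P', N)\<in>\<C>. \<Inter>h\<in>N. \<Union>e\<in>P. \<Union>e'\<in>P'. {y. 0 < slack (e, e', h) y})"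
    unfolding U_def by (auto; blast)
  moreover have "open (\<Inter>(P, P', N)\<in>\<C>. \<Inter>h\<in>N. \<Union>e\<in>P. \<Union>e'\<in>P'. {y. 0 < slack (e, e', h) y})"
    by (auto intro!: open_INT open_UN open_Collect_less continuous_on_const cont)
  ultimately have "open": "openin (top_of_set (coord_space K)) U"
    by (simp add: openin_open_Int)
  have "y \<in> closure U" if y: "y \<in> S" for y
  proof -
    define G where "G = {(e, e', h). (\<exists>P P' N. (P, P', N) \<in> \<C> \<and> e \<in> P \<and> e' \<in> P' \<and> h \<in> N) \<and>
      slack (e, e', h) y = 0}"
    have G: "\<exists>P P' N. (P, P', N) \<in> \<C> \<and> e \<in> P \<and> e' \<in> P' \<and> h \<in> N" if "(e, e', h) \<in> G" for e e' h
      using that by (auto simp: G_def)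
    have "\<exists>v. \<forall>g\<in>G. 0 < exchange g \<bullet> fibre_lift v"
    proof (rule increasing_direction[OF x, of G H y])
      show "{e, e', h} \<subseteq> support x" if "(e, e', h) \<in> G" for e e' h
        using G[OF that] dom by blast
      show "h \<in> H \<and> e \<notin> H \<and> e' \<notin> H" if "(e, e', h) \<in> G" for e e' h
        using G[OF that] heads by blast
      show "exchange g \<bullet> (real_part x + fibre_lift y) = 0" if "g \<in> G" for g
        using that by (auto simp: G_def slack_def r_def)
    qed
    then obtain v where v: "\<And>g. g \<in> G \<Longrightarrow> 0 < exchange g \<bullet> fibre_lift v"
      by blast
    \<comment> \<open>Truncating \<open>v\<close> to the coordinates in \<open>K\<close> keeps the path inside \<open>coord_space K\<close>; the tight
      triples do not see the difference because their matrix indices lie in \<open>K\<close>.\<close>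
    define w where "w = (\<chi> k. if k \<in> K then v $ k else 0)"
    have w: "0 < exchange (e, e', h) \<bullet> fibre_lift w" if "(e, e', h) \<in> G" for e e' h
    proof -
      have "{fst e, fst e', fst h} \<subseteq> K" using G[OF that] dom by blast
      then show ?thesis using v[OF that] by (simp add: inner_exchange w_def)
    qed
    have w_coord: "w \<in> coord_space K" by (simp add: w_def coord_space_def)
    have y_coord: "y \<in> coord_space K" using y by (simp add: S)
    define path where "path t = y + t *\<^sub>R w" for t
    have path_slack: "slack g (path t) = slack g y + t * (exchange g \<bullet> fibre_lift w)" for g t
      by (simp add: slack path_def inner_add_right flip: inner_fibre_sum)
    have lim: "(path \<longlongrightarrow> y) (at_right 0)"
      unfolding path_def by (auto intro!: tendsto_eq_intros)
    have "\<exists>e\<in>P. \<exists>e'\<in>P'. \<forall>\<^sub>F t in at_right 0. 0 < slack (e, e', h) (path t)"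
      if C: "(P, P', N) \<in> \<C>" "h \<in> N" for P P' N h
    proof -
      obtain e e' where e: "e \<in> P" "e' \<in> P'" "0 \<le> slack (e, e', h) y"
        using y C unfolding S by fast
      have "\<forall>\<^sub>F t in at_right 0. 0 < slack (e, e', h) (path t)"
      proof (cases "slack (e, e', h) y = 0")
        case True
        then have "(e, e', h) \<in> G" using C e by (auto simp: G_def)
        then have "0 < exchange (e, e', h) \<bullet> fibre_lift w" by (rule w)
        with True show ?thesis
          unfolding path_slack by (auto intro: eventually_mono[OF eventually_at_right_less])
      next
        case False
        with e have "0 < slack (e, e', h) y" by simp
        moreover have "((\<lambda>t. slack (e, e', h) (path t)) \<longlongrightarrow> slack (e, e', h) y) (at_right 0)"
          unfolding slack by (intro tendsto_intros lim)
        ultimately show ?thesis by (rule order_tendstoD(1)[rotated])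
      qed
      with e show ?thesis by blast
    qed
    then have ev: "\<forall>\<^sub>F t in at_right 0. \<exists>e\<in>P. \<exists>e'\<in>P'. 0 < slack (e, e', h) (path t)"
      if "(P, P', N) \<in> \<C>" "h \<in> N" for P P' N h
      using that by (fastforce elim: eventually_mono)
    have "\<forall>\<^sub>F t in at_right 0. \<forall>(P, P', N)\<in>\<C>. \<forall>h\<in>N. \<exists>e\<in>P. \<exists>e'\<in>P'. 0 < slack (e, e', h) (path t)"
      using ev by (auto intro!: eventually_ball_finite)
    then have "\<forall>\<^sub>F t in at_right 0. path t \<in> U"
      using subspace_coord_space[of K] w_coord y_coord
      by (auto simp: U_def path_def subspace_def elim: eventually_mono)
    then have "\<forall>\<^sub>F t in at_right 0. path t \<in> closure U"
      by (rule eventually_mono) (use closure_subset in blast)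
    with lim show ?thesis
      by (intro Lim_in_closed_set[OF closed_closure]) (simp_all add: trivial_limit_at_right_real)
  qed
  moreover have "U \<subseteq> S" unfolding U_def S by (fastforce intro: less_imp_le)
  ultimately have "regular_in K S"
    using closed "open" by (intro regular_inI[of K S U]) auto
  then show ?thesis by (simp add: S_def r_def)
qed

section \<open>Maxima as dominance conditions\<close>

lemma SUP_ereal_finite:
  fixes f :: "'e::finite \<Rightarrow> real"
  obtains "A = {}" "(SUP e\<in>A. ereal (f e)) = -\<infinity>"
  | e where "e \<in> A" "(SUP e\<in>A. ereal (f e)) = ereal (f e)" "\<And>e'. e' \<in> A \<Longrightarrow> f e' \<le> f e"
proof (cases "A = {}")
  case True
  then show ?thesis using that(1) by (simp add: bot_ereal_def)
next
  case False
  then have "Max (f ` A) \<in> f ` A" by (intro Max_in) auto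
  then obtain e where e: "e \<in> A" "f e = Max (f ` A)" by auto
  then have le: "f e' \<le> f e" if "e' \<in> A" for e' using that by simp
  then have "(SUP e\<in>A. ereal (f e)) = ereal (f e)"
    using e(1) by (intro SUP_eqI) auto
  then show ?thesis using that(2) e(1) le by blast
qed

text \<open>
  Nonempty finite maxima are attained.  If \<open>P\<close> or \<open>P'\<close> is empty, then the right side is \<open>-\<infinity>\<close>, which
  bounds the left side only if \<open>N\<close> is empty.
\<close>

lemma double_SUP_le_iff:
  fixes f :: "'e::finite \<Rightarrow> real"
  shows "2 * (SUP h\<in>N. ereal (f h)) \<le> (SUP e\<in>P. ereal (f e)) + (SUP e\<in>P'. ereal (f e)) \<longleftrightarrow>
    (\<forall>h\<in>N. \<exists>e\<in>P. \<exists>e'\<in>P'. 2 * f h \<le> f e + f e')"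
proof (cases rule: SUP_ereal_finite[of N f])
  case 1
  show ?thesis unfolding 1(2) by (simp add: 1(1))
next
  case (2 h)
  show ?thesis
  proof (cases rule: SUP_ereal_finite[of P f])
    case 1
    show ?thesis
      unfolding 2(2) 1(2) using 1(1) 2(1)
      by (cases rule: SUP_ereal_finite[of P' f]) (auto simp: bot_ereal_def)
  next
    case P: (2 p)
    show ?thesis
    proof (cases rule: SUP_ereal_finite[of P' f])
      case 1
      show ?thesis
        unfolding 2(2) P(2) 1(2) using 1(1) 2(1) by auto
    next
      case P': (2 p')
      have "2 * f h \<le> f p + f p' \<longleftrightarrow> (\<forall>h\<in>N. \<exists>e\<in>P. \<exists>e'\<in>P'. 2 * f h \<le> f e + f e')"
      proof
        assume "2 * f h \<le> f p + f p'"
        then have "2 * f h' \<le> f p + f p'" if "h' \<in> N" for h'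
          using 2(3)[OF that] by linarith
        then show "\<forall>h\<in>N. \<exists>e\<in>P. \<exists>e'\<in>P'. 2 * f h \<le> f e + f e'"
          using P(1) P'(1) by blast
      next
        assume "\<forall>h\<in>N. \<exists>e\<in>P. \<exists>e'\<in>P'. 2 * f h \<le> f e + f e'"
        then obtain e e' where "e \<in> P" "e' \<in> P'" "2 * f h \<le> f e + f e'"
          using 2(1) by blast
        then show "2 * f h \<le> f p + f p'"
          using P(3)[of e] P'(3)[of e'] by linarith
      qed
      then show ?thesis by (simp add: 2(2) P(2) P'(2))
    qed
  qed
qed

lemma ereal_double_le_iff: "2 * a \<le> b + b \<longleftrightarrow> a \<le> (b :: ereal)"
  by (cases a; cases b) auto

section \<open>The strata as dominance sets\<close>

text \<open>
  Sorting the two indices makes \<open>entry k i j\<close> meaningful for all \<open>i\<close>, \<open>j\<close>, in accordance with the symmetry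
  of the matrices.
\<close>

definition entry :: "'n \<Rightarrow> 'm \<Rightarrow> 'm \<Rightarrow> 'n \<times> 'm::linorder upper_pair"
  where "entry k i j = (k, Abs_upper_pair (min i j, max i j))"

lemma fst_entry [simp]: "fst (entry k i j) = k"
  by (simp add: entry_def)

lemma Rep_Abs_upper_pair: "Rep_upper_pair (Abs_upper_pair (min i j, max i j)) = (min i j, max i j)"
  by (rule Abs_upper_pair_inverse) (auto simp: min_def max_def)

lemma entry_eq_iff:
  assumes "i \<le> j" "i' \<le> j'"
  shows "entry k i j = entry k' i' j' \<longleftrightarrow> k = k' \<and> i = i' \<and> j = j'"
  using assms by (simp add: entry_def min_absorb1 max_absorb2 Abs_upper_pair_inject)

lemma moduli_vector_entry:
  assumes "transpose (Q k) = Q k"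
  shows "moduli_vector Q $ entry k i j = modulus (Q k $ i $ j)"
proof -
  have "Q k $ i $ j = Q k $ j $ i"
    using arg_cong[OF assms, of "\<lambda>A. A $ j $ i"] by (simp add: transpose_def)
  then show ?thesis
    by (simp add: moduli_vector_def entry_def Rep_Abs_upper_pair) (auto simp: min_def max_def)
qed

lemma modulus_not_PInfty [simp]: "modulus q \<noteq> \<infinity>"
  by (cases q) auto

lemma moduli_vector_tropical: "moduli_vector Q \<in> tropical_space"
  by (auto simp: tropical_space_def moduli_vector_def split: prod.split)

lemma modulus_signed:
  assumes "q \<in> tropical_pos \<union> tropical_neg"
  shows "modulus q \<noteq> -\<infinity>" "ereal (real_of_ereal (modulus q)) = modulus q"
  using assms by (auto simp: tropical_pos_def tropical_neg_def)

lemma tropical_pos_neg_disjoint: "q \<in> tropical_pos \<Longrightarrow> q \<notin> tropical_neg"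
  by (auto simp: tropical_pos_def tropical_neg_def)

definition entries ::
  "('n \<Rightarrow> signed_tropical ^ ('m::{finite,linorder}) ^ ('m::{finite,linorder})) \<Rightarrow> 'n set
    \<Rightarrow> signed_tropical set \<Rightarrow> 'm \<Rightarrow> 'm \<Rightarrow> ('n \<times> 'm upper_pair) set"
  where "entries Q K A i j = (\<lambda>k. entry k i j) ` {k \<in> K. Q k $ i $ j \<in> A}"

text \<open>
  The matrices with number outside \<open>K\<close> contribute \<open>-\<infinity>\<close> to the maximum, so it may be
  taken over the finite entries of the matrices in \<open>K\<close> only.  With \<open>A\<close> the positive or the negative
  numbers, the left side is \<open>Qplus\<close> or \<open>Qminus\<close>.
\<close>

lemma SUP_entries:
  fixes Q :: "'n::finite \<Rightarrow> signed_tropical ^ ('m::{finite,linorder}) ^ ('m::{finite,linorder})"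
  assumes sym: "\<And>k. transpose (Q k) = Q k" and A: "A \<subseteq> tropical_pos \<union> tropical_neg"
  shows "(SUP k\<in>{k. Q k $ i $ j \<in> A}. modulus (Q k $ i $ j) + from_real K y $ k) =
    (SUP e\<in>entries Q K A i j. ereal ((real_part (moduli_vector Q) + fibre_lift y) $ e))"
    (is "?L = ?R")
proof (rule antisym)
  have term_eq: "modulus (Q k $ i $ j) + from_real K y $ k =
      ereal ((real_part (moduli_vector Q) + fibre_lift y) $ entry k i j)"
    if "k \<in> K" "Q k $ i $ j \<in> A" for k
    using that A modulus_signed(2)[of "Q k $ i $ j"]
    by (auto simp: from_real_def real_part_def moduli_vector_entry sym simp flip: plus_ereal.simps(1))
  have outside: "modulus (Q k $ i $ j) + from_real K y $ k = -\<infinity>" if "k \<notin> K" for k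
    using that by (simp add: from_real_def)
  show "?L \<le> ?R"
  proof (rule SUP_least)
    fix k assume k: "k \<in> {k. Q k $ i $ j \<in> A}"
    show "modulus (Q k $ i $ j) + from_real K y $ k \<le> ?R"
    proof (cases "k \<in> K")
      case True
      with k show ?thesis
        by (auto simp: term_eq entries_def intro!: SUP_upper2[of "entry k i j"])
    qed (simp add: outside)
  qed
  show "?R \<le> ?L"
  proof (rule SUP_least)
    fix e assume "e \<in> entries Q K A i j"
    then obtain k where k: "k \<in> K" "Q k $ i $ j \<in> A" "e = entry k i j"
      by (auto simp: entries_def)
    then show "ereal ((real_part (moduli_vector Q) + fibre_lift y) $ e) \<le> ?L"
      unfolding k(3) by (auto simp flip: term_eq simp del: vector_add_component intro!: SUP_upper)
  qed
qed

text \<open>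
  In a comparison of two maxima the larger side is both sets of tails.  Splitting on whether \<open>D\<close> is
  \<open>\<ge>\<close> makes exactly one of \<open>ge\<close> and \<open>le\<close> apply to each pair outside \<open>\<Sigma>\<close>, so that no entry becomes
  a head and a tail.
\<close>

inductive dominance_constraint ::
  "(('m::{finite,linorder}) \<times> 'm) set \<Rightarrow> ('m \<times> 'm \<Rightarrow> ereal \<Rightarrow> ereal \<Rightarrow> bool)
    \<Rightarrow> ('n \<Rightarrow> signed_tropical ^ ('m::{finite,linorder}) ^ ('m::{finite,linorder})) \<Rightarrow> 'n set
    \<Rightarrow> ('n \<times> 'm upper_pair) set \<Rightarrow> ('n \<times> 'm upper_pair) set \<Rightarrow> ('n \<times> 'm upper_pair) set \<Rightarrow> bool"
  for \<Sigma> D Q K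
where
  diag: "dominance_constraint \<Sigma> D Q K
    (entries Q K tropical_pos i i) (entries Q K tropical_pos i i) (entries Q K tropical_neg i i)"
| minor: "(i, j) \<in> \<Sigma> \<Longrightarrow> dominance_constraint \<Sigma> D Q K
    (entries Q K tropical_pos i i) (entries Q K tropical_pos j j)
    (entries Q K tropical_pos i j \<union> entries Q K tropical_neg i j)"
| ge: "(i, j) \<in> strict_pairs - \<Sigma> \<Longrightarrow> D (i, j) = (\<ge>) \<Longrightarrow> dominance_constraint \<Sigma> D Q K
    (entries Q K tropical_pos i j) (entries Q K tropical_pos i j) (entries Q K tropical_neg i j)"
| le: "(i, j) \<in> strict_pairs - \<Sigma> \<Longrightarrow> D (i, j) \<noteq> (\<ge>) \<Longrightarrow> dominance_constraint \<Sigma> D Q K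
    (entries Q K tropical_neg i j) (entries Q K tropical_neg i j) (entries Q K tropical_pos i j)"

lemma stratum_tropical_S:
  fixes Q :: "'n::finite \<Rightarrow> signed_tropical ^ ('m::{finite,linorder}) ^ ('m::{finite,linorder})"
  assumes sym: "\<And>k. transpose (Q k) = Q k"
    and D: "D \<in> (strict_pairs - \<Sigma>) \<rightarrow> {(\<le>), (\<ge>)}"
  shows "stratum K (tropical_S \<Sigma> D Q) =
    dominance_set K (real_part (moduli_vector Q))
      {(P, P', N). dominance_constraint \<Sigma> D Q K P P' N}"
proof -
  define pos where "pos = entries Q K tropical_pos"
  define neg where "neg = entries Q K tropical_neg"
  define dominates where "dominates y P P' N \<longleftrightarrow> (\<forall>h\<in>N. \<exists>e\<in>P. \<exists>e'\<in>P'.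
    0 \<le> exchange (e, e', h) \<bullet> (real_part (moduli_vector Q) + fibre_lift y))" for y P P' N
  define M where "M y A = (SUP e\<in>A. ereal ((real_part (moduli_vector Q) + fibre_lift y) $ e))" for y A
  have Qp: "Qplus Q i j (from_real K y) = M y (pos i j)" for i j y
    unfolding Qplus_def M_def pos_def by (rule SUP_entries[OF sym]) simp
  have Qm: "Qminus Q i j (from_real K y) = M y (neg i j)" for i j y
    unfolding Qminus_def M_def neg_def by (rule SUP_entries[OF sym]) simp
  have dom: "2 * M y N \<le> M y P + M y P' \<longleftrightarrow> dominates y P P' N" for y P P' N
    unfolding M_def dominates_def double_SUP_le_iff inner_exchange by simp
  have dom': "M y N \<le> M y P \<longleftrightarrow> dominates y P P N" for y P N
    unfolding dom[symmetric] ereal_double_le_iff ..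
  have Un: "max (M y A) (M y B) = M y (A \<union> B)" for y A B
    by (simp add: M_def SUP_union sup_max)
  have offdiag: "D (i, j) (M y (pos i j)) (M y (neg i j)) \<longleftrightarrow>
      (if D (i, j) = (\<ge>) then dominates y (pos i j) (pos i j) (neg i j)
       else dominates y (neg i j) (neg i j) (pos i j))"
    if "(i, j) \<in> strict_pairs - \<Sigma>" for i j y
  proof -
    have "D (i, j) = (\<le>) \<or> D (i, j) = (\<ge>)" using D that by auto
    then show ?thesis by (auto simp flip: dom')
  qed
  have tropical: "tropical_S \<Sigma> D Q \<subseteq> tropical_space" by (auto simp: tropical_S_def)
  have "from_real K y \<in> tropical_S \<Sigma> D Q \<longleftrightarrow>
      (\<forall>P P' N. dominance_constraint \<Sigma> D Q K P P' N \<longrightarrow> dominates y P P' N)" for y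
  proof -
    have "from_real K y \<in> tropical_S \<Sigma> D Q \<longleftrightarrow>
        (\<forall>i. dominates y (pos i i) (pos i i) (neg i i)) \<and>
        (\<forall>(i, j)\<in>\<Sigma>. dominates y (pos i i) (pos j j) (pos i j \<union> neg i j)) \<and>
        (\<forall>(i, j)\<in>strict_pairs - \<Sigma>. D (i, j) (M y (pos i j)) (M y (neg i j)))"
      unfolding tropical_S_def mem_Collect_eq Qp Qm Un dom dom' by (simp add: from_real(1))
    also have "\<dots> \<longleftrightarrow> (\<forall>i. dominates y (pos i i) (pos i i) (neg i i)) \<and>
        (\<forall>(i, j)\<in>\<Sigma>. dominates y (pos i i) (pos j j) (pos i j \<union> neg i j)) \<and>
        (\<forall>(i, j)\<in>strict_pairs - \<Sigma>. if D (i, j) = (\<ge>) then dominates y (pos i j) (pos i j) (neg i j)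
           else dominates y (neg i j) (neg i j) (pos i j))" (is "_ \<longleftrightarrow> ?all")
      by (intro conj_cong refl ball_cong) (clarify, rule offdiag, blast)
    also have "\<dots> \<longleftrightarrow> (\<forall>P P' N. dominance_constraint \<Sigma> D Q K P P' N \<longrightarrow> dominates y P P' N)"
    proof
      assume all: ?all
      have "dominates y P P' N" if "dominance_constraint \<Sigma> D Q K P P' N" for P P' N
        using that
      proof cases
        case (diag i)
        then show ?thesis using all by (simp add: pos_def neg_def)
      next
        case (minor i j)
        then show ?thesis using all by (fastforce simp: pos_def neg_def)
      next
        case (ge i j)
        then show ?thesis using bspec[OF conjunct2[OF conjunct2[OF all]], of "(i, j)"]
          by (simp add: pos_def neg_def)
      next
        case (le i j)
        then show ?thesis using bspec[OF conjunct2[OF conjunct2[OF all]], of "(i, j)"]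
          by (simp add: pos_def neg_def)
      qed
      then show "\<forall>P P' N. dominance_constraint \<Sigma> D Q K P P' N \<longrightarrow> dominates y P P' N" by blast
    next
      assume "\<forall>P P' N. dominance_constraint \<Sigma> D Q K P P' N \<longrightarrow> dominates y P P' N"
      then have all: "dominates y P P' N" if "dominance_constraint \<Sigma> D Q K P P' N" for P P' N
        using that by blast
      show ?all
        unfolding pos_def neg_def
        by (intro conjI allI ballI) (auto intro!: all dominance_constraint.intros)
    qed
    finally show ?thesis .
  qed
  then show ?thesis
    unfolding stratum_tropical[OF tropical] by (simp add: dominance_set_def dominates_def)
qed

section \<open>Generic matrices\<close>

text \<open>
  The set \<open>H\<close> in the proof consists of the entries that can be heads.  It avoids all tails: an
  entry with index in \<open>\<Sigma>\<close> is a head whatever its sign and never a tail, and for all other indices the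
  sign separates heads from tails.  In particular a minor condition has its tails on the diagonal, and
  those are positive, whereas the heads on the diagonal are negative.
\<close>

lemma regular_stratum_tropical_S:
  fixes Q :: "'n::finite \<Rightarrow> signed_tropical ^ ('m::{finite,linorder}) ^ ('m::{finite,linorder})"
  assumes sym: "\<And>k. transpose (Q k) = Q k" and gen: "moduli_vector Q \<notin> exceptional_set"
    and \<Sigma>: "\<Sigma> \<subseteq> strict_pairs" and D: "D \<in> (strict_pairs - \<Sigma>) \<rightarrow> {(\<le>), (\<ge>)}"
  shows "regular_in K (stratum K (tropical_S \<Sigma> D Q))"
proof -
  define H where "H = {entry k i j | k i j. i \<le> j \<and>
    (i = j \<and> Q k $ i $ j \<in> tropical_neg \<or> (i, j) \<in> \<Sigma> \<or>
     (i, j) \<in> strict_pairs - \<Sigma> \<and> Q k $ i $ j \<in> (if D (i, j) = (\<ge>) then tropical_neg else tropical_pos))}"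
  have H_iff: "entry k i j \<in> H \<longleftrightarrow>
      (i = j \<and> Q k $ i $ j \<in> tropical_neg \<or> (i, j) \<in> \<Sigma> \<or>
       (i, j) \<in> strict_pairs - \<Sigma> \<and> Q k $ i $ j \<in> (if D (i, j) = (\<ge>) then tropical_neg else tropical_pos))"
    if "i \<le> j" for k i j
    using that unfolding H_def by (auto simp: entry_eq_iff)
  have strict: "i < j" if "(i, j) \<in> strict_pairs" for i j :: 'm
    using that by (simp add: strict_pairs_def)
  then have diag_notin: "(i, i) \<notin> strict_pairs" "(i, i) \<notin> \<Sigma>" for i
    using \<Sigma> by blast+
  have supp: "entries Q K A i j \<subseteq> support (moduli_vector Q)" "entries Q K A i j \<subseteq> fst -` K"
    if "A \<subseteq> tropical_pos \<union> tropical_neg" for A i j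
    using subsetD[OF that] modulus_signed(1)
    by (auto simp: entries_def support_def moduli_vector_entry sym)
  show ?thesis
    unfolding stratum_tropical_S[OF sym D]
  proof (rule regular_dominance_set[OF moduli_vector_tropical gen, of _ _ H])
    fix P P' N assume "(P, P', N) \<in> {(P, P', N). dominance_constraint \<Sigma> D Q K P P' N}"
    then have "dominance_constraint \<Sigma> D Q K P P' N" by simp
    then show "P \<union> P' \<union> N \<subseteq> support (moduli_vector Q) \<inter> fst -` K"
      by cases (simp_all add: supp)
  next
    fix P P' N assume "(P, P', N) \<in> {(P, P', N). dominance_constraint \<Sigma> D Q K P P' N}"
    then have "dominance_constraint \<Sigma> D Q K P P' N" by simp
    then show "N \<subseteq> H \<and> P \<inter> H = {} \<and> P' \<inter> H = {}"
    proof cases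
      case (diag i)
      then show ?thesis
        by (auto simp: entries_def H_iff diag_notin dest: tropical_pos_neg_disjoint)
    next
      case (minor i j)
      with \<Sigma> strict have "i \<le> j" by force
      with minor show ?thesis
        by (auto simp: entries_def H_iff diag_notin dest: tropical_pos_neg_disjoint)
    next
      case (ge i j)
      with strict have "i < j" by force
      with ge show ?thesis
        by (auto simp: entries_def H_iff dest: tropical_pos_neg_disjoint)
    next
      case (le i j)
      with strict have "i < j" by force
      with le show ?thesis
        by (auto simp: entries_def H_iff dest: tropical_pos_neg_disjoint)
    qed
  qed
qed

text \<open>
  Equality would make the triple \<open>(Q\<^sub>i\<^sub>i, Q\<^sub>j\<^sub>j, Q\<^sub>i\<^sub>j)\<close> tight at every point, in particular at \<open>0\<close>.  All
  three entries belong to matrix \<open>k\<close>, so moving along \<open>v\<close> changes its slack by \<open>v\<^sub>k + v\<^sub>k - 2 v\<^sub>k = 0\<close>,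
  and no direction increases it.
\<close>

lemma diagonal_sum_neq:
  fixes Q :: "'n::finite \<Rightarrow> signed_tropical ^ ('m::{finite,linorder}) ^ ('m::{finite,linorder})"
  assumes sym: "\<And>k. transpose (Q k) = Q k" and gen: "moduli_vector Q \<notin> exceptional_set"
    and "i \<noteq> j" and pos: "Q k $ i $ i \<in> tropical_pos" "Q k $ j $ j \<in> tropical_pos"
  shows "modulus (Q k $ i $ i) + modulus (Q k $ j $ j) \<noteq> 2 * modulus (Q k $ i $ j)"
proof
  assume eq: "modulus (Q k $ i $ i) + modulus (Q k $ j $ j) = 2 * modulus (Q k $ i $ j)"
  obtain a b where ab: "Q k $ i $ i = TPos a" "Q k $ j $ j = TPos b"
    using pos by (auto simp: tropical_pos_def)
  obtain c where c: "modulus (Q k $ i $ j) = ereal c"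
    using eq ab by (cases "Q k $ i $ j") auto
  note mod = moduli_vector_entry[of Q, OF sym]
  let ?g = "(entry k i i, entry k j j, entry k i j)"
  have ne: "entry k i j \<noteq> entry k i i" "entry k i j \<noteq> entry k j j"
    using \<open>i \<noteq> j\<close> Rep_Abs_upper_pair[of i j] Rep_Abs_upper_pair[of i i] Rep_Abs_upper_pair[of j j]
    by (auto simp: entry_def min_def max_def split: if_splits)
  have "\<exists>v :: real ^ 'n. \<forall>g\<in>{?g}. 0 < exchange g \<bullet> fibre_lift v"
  proof (rule increasing_direction[OF moduli_vector_tropical gen, of "{?g}" "{entry k i j}" 0])
    show "{e, e', h} \<subseteq> support (moduli_vector Q)" if "(e, e', h) \<in> {?g}" for e e' h
      using that ab c by (auto simp: support_def mod)
    show "exchange g \<bullet> (real_part (moduli_vector Q) + fibre_lift 0) = 0" if "g \<in> {?g}" for g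
      using that eq ab c by (auto simp: inner_exchange real_part_def mod)
  qed (use ne in auto)
  then show False by (simp add: inner_exchange)
qed

theorem theorem5p24:
  "\<exists>X :: (ereal ^ ('n::finite \<times> 'm::{finite,linorder} upper_pair)) set.
     X \<subseteq> tropical_space \<and>
     (\<forall>K. K \<noteq> {} \<longrightarrow> finite_union_of_hyperplanes_in K (stratum K X)) \<and>
     (\<forall>Q :: 'n \<Rightarrow> signed_tropical ^ ('m::{finite,linorder}) ^ ('m::{finite,linorder}).
        (\<forall>k. transpose (Q k) = Q k) \<longrightarrow> moduli_vector Q \<notin> X \<longrightarrow>
        (\<forall>k i j. i \<noteq> j \<longrightarrow> Q k $ i $ i \<in> tropical_pos \<longrightarrow> Q k $ j $ j \<in> tropical_pos \<longrightarrow>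
           modulus (Q k $ i $ i) + modulus (Q k $ j $ j) \<noteq> 2 * modulus (Q k $ i $ j)) \<and>
        (\<forall>\<Sigma> D. \<Sigma> \<subseteq> strict_pairs \<longrightarrow> D \<in> (strict_pairs - \<Sigma>) \<rightarrow> {(\<le>), (\<ge>)} \<longrightarrow>
           (\<forall>K. K \<noteq> {} \<longrightarrow> regular_in K (stratum K (tropical_S \<Sigma> D Q)))))"
proof (intro exI[of _ exceptional_set] conjI allI impI)
  show "exceptional_set \<subseteq> (tropical_space :: (ereal ^ ('n \<times> 'm upper_pair)) set)"
    by (auto simp: exceptional_set_def)
next
  fix K :: "('n \<times> 'm upper_pair) set"
  show "finite_union_of_hyperplanes_in K (stratum K exceptional_set)"
    by (rule stratum_exceptional_set)
next
  fix Q :: "'n \<Rightarrow> signed_tropical ^ ('m::{finite,linorder}) ^ ('m::{finite,linorder})"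
  assume "\<forall>k. transpose (Q k) = Q k" and gen: "moduli_vector Q \<notin> exceptional_set"
  then have sym: "transpose (Q k) = Q k" for k by simp
  show "modulus (Q k $ i $ i) + modulus (Q k $ j $ j) \<noteq> 2 * modulus (Q k $ i $ j)"
    if "i \<noteq> j" "Q k $ i $ i \<in> tropical_pos" "Q k $ j $ j \<in> tropical_pos" for k i j
    using sym gen that by (rule diagonal_sum_neq)
  show "regular_in K (stratum K (tropical_S \<Sigma> D Q))"
    if "\<Sigma> \<subseteq> strict_pairs" "D \<in> (strict_pairs - \<Sigma>) \<rightarrow> {(\<le>), (\<ge>)}" for \<Sigma> D K
    using sym gen that by (rule regular_stratum_tropical_S)
qed

end
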